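(* Let $G$ be a group, let $R$ be a $G$-graded ring with unity, and let $P$ be a graded ideal of $R$ (i.e. a proper two-sided ideal that is graded). Then $P$ is a graded almost prime right ideal of $R$ if and only if $P$ is a graded almost prime ideal of $R$.
   Context: Rings are associative and not assumed commutative; here $R$ has unity. A ring $R$ is $G$-graded if $R=\bigoplus_{g\in G}R_g$ with $R_g$ additive subgroups and $R_gR_h\subseteq R_{gh}$ for all $g,h\in G$; $x_g$ denotes the component of $x\in R$ in $R_g$. A (one- or two-sided) ideal $P$ is graded if $P=\bigoplus_{g\in G}(P\cap R_g)$, i.e. $x\in P$ implies $x_g\in P$ for all $g\in G$. By "ideal" is meant a proper two-sided ideal. For $X,Y\subseteq R$ one-sided or two-sided ideals, $XY$ is the set of finite sums of products $xy$ with $x\in X$, $y\in Y$, and $P^2=PP$. A proper graded right ideal $P$ of $R$ is a graded almost prime right ideal if, for all graded right ideals $X,Y$ of $R$, $XY\subseteq P$ and $XY\nsubseteq P^2$ imply $X\subseteq P$ or $Y\subseteq P$. A graded ideal $P$ of $R$ is a graded almost prime ideal if, for all graded two-sided ideals $X,Y$ of $R$, $XY\subseteq P$ and $XY\nsubseteq P^2$ imply $X\subseteq P$ or $Y\subseteq P$. *)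

theory Defs
  imports "HOL-Algebra.Ideal_Product"
begin

definition homogeneous_decomposition ::
  "('g, 'h) monoid_scheme \<Rightarrow> ('a, 'r) ring_scheme \<Rightarrow> ('g \<Rightarrow> 'a set) \<Rightarrow> 'a \<Rightarrow> ('g \<Rightarrow> 'a) \<Rightarrow> bool"
  where "homogeneous_decomposition G R A x f \<longleftrightarrow>
    f \<in> (\<Pi>\<^sub>E g\<in>carrier G. A g) \<and>
    finite {g \<in> carrier G. f g \<noteq> \<zero>\<^bsub>R\<^esub>} \<and>
    x = finsum R f {g \<in> carrier G. f g \<noteq> \<zero>\<^bsub>R\<^esub>}"

text \<open>The ring \<^term>\<open>R\<close> is the internal direct sum of the additive subgroups \<^term>\<open>A g\<close>:
  every element has exactly one decomposition with finite support.\<close>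

locale graded_ring = group G + ring R
  for G :: "('g, 'h) monoid_scheme" and R :: "('a, 'r) ring_scheme" and A :: "'g \<Rightarrow> 'a set" +
  assumes component_subgroup: "g \<in> carrier G \<Longrightarrow> additive_subgroup (A g) R"
    and direct_sum: "x \<in> carrier R \<Longrightarrow> \<exists>!f. homogeneous_decomposition G R A x f"
    and mult_graded: "\<lbrakk>g \<in> carrier G; h \<in> carrier G; x \<in> A g; y \<in> A h\<rbrakk>
      \<Longrightarrow> x \<otimes>\<^bsub>R\<^esub> y \<in> A (g \<otimes>\<^bsub>G\<^esub> h)"

definition homogeneous_component ::
  "('g, 'h) monoid_scheme \<Rightarrow> ('a, 'r) ring_scheme \<Rightarrow> ('g \<Rightarrow> 'a set) \<Rightarrow> 'g \<Rightarrow> 'a \<Rightarrow> 'a"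
  where "homogeneous_component G R A g x = (THE f. homogeneous_decomposition G R A x f) g"

definition graded_subset ::
  "('g, 'h) monoid_scheme \<Rightarrow> ('a, 'r) ring_scheme \<Rightarrow> ('g \<Rightarrow> 'a set) \<Rightarrow> 'a set \<Rightarrow> bool"
  where "graded_subset G R A P \<longleftrightarrow>
    (\<forall>x\<in>P. \<forall>g\<in>carrier G. homogeneous_component G R A g x \<in> P)"

locale right_ideal = additive_subgroup I R + ring R for I and R (structure) +
  assumes right_closed: "\<lbrakk>a \<in> I; x \<in> carrier R\<rbrakk> \<Longrightarrow> a \<otimes> x \<in> I"

text \<open>Properness is not part of the next two notions; it is stated separately where required.\<close>

definition graded_right_ideal ::
  "('g, 'h) monoid_scheme \<Rightarrow> ('a, 'r) ring_scheme \<Rightarrow> ('g \<Rightarrow> 'a set) \<Rightarrow> 'a set \<Rightarrow> bool"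
  where "graded_right_ideal G R A P \<longleftrightarrow> right_ideal P R \<and> graded_subset G R A P"

definition graded_two_sided_ideal ::
  "('g, 'h) monoid_scheme \<Rightarrow> ('a, 'r) ring_scheme \<Rightarrow> ('g \<Rightarrow> 'a set) \<Rightarrow> 'a set \<Rightarrow> bool"
  where "graded_two_sided_ideal G R A P \<longleftrightarrow> ideal P R \<and> graded_subset G R A P"

text \<open>The set \<^term>\<open>ideal_prod R X Y\<close> (the least set containing all products and closed
  under addition) consists of the nonempty finite sums of products. For ideals, one-sided or not,
  the empty sum \<open>\<zero> = \<zero> \<otimes> \<zero>\<close> is one of them.\<close>

definition graded_almost_prime_right_ideal ::
  "('g, 'h) monoid_scheme \<Rightarrow> ('a, 'r) ring_scheme \<Rightarrow> ('g \<Rightarrow> 'a set) \<Rightarrow> 'a set \<Rightarrow> bool"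
  where "graded_almost_prime_right_ideal G R A P \<longleftrightarrow>
    graded_right_ideal G R A P \<and> P \<noteq> carrier R \<and>
    (\<forall>X Y. graded_right_ideal G R A X \<and> graded_right_ideal G R A Y \<and>
      X \<cdot>\<^bsub>R\<^esub> Y \<subseteq> P \<and> \<not> X \<cdot>\<^bsub>R\<^esub> Y \<subseteq> P \<cdot>\<^bsub>R\<^esub> P \<longrightarrow> X \<subseteq> P \<or> Y \<subseteq> P)"

definition graded_almost_prime_ideal ::
  "('g, 'h) monoid_scheme \<Rightarrow> ('a, 'r) ring_scheme \<Rightarrow> ('g \<Rightarrow> 'a set) \<Rightarrow> 'a set \<Rightarrow> bool"
  where "graded_almost_prime_ideal G R A P \<longleftrightarrow>
    graded_two_sided_ideal G R A P \<and> P \<noteq> carrier R \<and>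
    (\<forall>X Y. graded_two_sided_ideal G R A X \<and> graded_two_sided_ideal G R A Y \<and>
      X \<cdot>\<^bsub>R\<^esub> Y \<subseteq> P \<and> \<not> X \<cdot>\<^bsub>R\<^esub> Y \<subseteq> P \<cdot>\<^bsub>R\<^esub> P \<longrightarrow> X \<subseteq> P \<or> Y \<subseteq> P)"

end

theory Submission
  imports Defs
begin

text \<open>
  Every two-sided ideal is a right ideal, so being almost prime for right ideals is the formally
  stronger property. Conversely, let \<open>P\<close> be almost prime for two-sided ideals, and let \<open>X\<close>, \<open>Y\<close> be
  graded right ideals with \<open>XY \<subseteq> P\<close> and \<open>\<not> XY \<subseteq> P\<^sup>2\<close>. Replace \<open>X\<close> and \<open>Y\<close> by the two-sided ideals
  \<open>RX\<close> and \<open>RY\<close> that they generate. Since \<open>X\<close> absorbs scalars on the right and \<open>P\<close> on the left,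
  \<open>(RX)(RY) = R(XR)Y \<subseteq> R(XY) \<subseteq> RP \<subseteq> P\<close> (\<open>carrier_prod_prod_subset\<close>).
  Since \<open>R\<close> has a unit, \<open>X \<subseteq> RX\<close> and \<open>Y \<subseteq> RY\<close>; hence \<open>(RX)(RY)\<close> contains \<open>XY\<close> and is still not
  inside \<open>P\<^sup>2\<close>. So one of \<open>RX\<close>, \<open>RY\<close>, and with it \<open>X\<close> or \<open>Y\<close>, lies in \<open>P\<close>.

  What remains is that \<open>RX\<close> and \<open>RY\<close> are graded (\<open>graded_subset_ideal_prod\<close>). The product of
  two graded additive subgroups is additively generated by products of homogeneous elements, and
  an additive subgroup generated by homogeneous elements is graded because taking a component is
  additive.
\<close>

section \<open>Products of additive subgroups\<close>

lemma ideal_prod_mono: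
  assumes "X \<subseteq> X'" and "Y \<subseteq> Y'"
  shows "X \<cdot>\<^bsub>R\<^esub> Y \<subseteq> X' \<cdot>\<^bsub>R\<^esub> Y'"
proof
  fix s assume "s \<in> X \<cdot>\<^bsub>R\<^esub> Y"
  then show "s \<in> X' \<cdot>\<^bsub>R\<^esub> Y'"
    by induct (use assms in \<open>auto intro: ideal_prod.intros\<close>)
qed

context ring
begin

lemma ideal_imp_right_ideal: "ideal I R \<Longrightarrow> right_ideal I R"
  by (simp add: ideal_def ideal_axioms_def right_ideal_def right_ideal_axioms_def)

lemma ideal_prod_subset_additive_subgroup:
  assumes "additive_subgroup H R" and "\<And>x y. x \<in> X \<Longrightarrow> y \<in> Y \<Longrightarrow> x \<otimes> y \<in> H"
  shows "X \<cdot> Y \<subseteq> H"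
proof
  fix s assume "s \<in> X \<cdot> Y"
  then show "s \<in> H"
    by induct (use assms in \<open>auto intro: additive_subgroup.a_closed\<close>)
qed

lemma ideal_prod_closed:
  assumes "X \<subseteq> carrier R" and "Y \<subseteq> carrier R"
  shows "X \<cdot> Y \<subseteq> carrier R"
proof
  fix s assume "s \<in> X \<cdot> Y"
  then show "s \<in> carrier R"
    by induct (use assms in auto)
qed

lemma additive_subgroup_ideal_prod:
  assumes X: "additive_subgroup X R" and Y: "additive_subgroup Y R"
  shows "additive_subgroup (X \<cdot> Y) R"
proof -
  interpret X: additive_subgroup X R by (rule X)
  interpret Y: additive_subgroup Y R by (rule Y)
  have closed: "X \<cdot> Y \<subseteq> carrier R"
    by (rule ideal_prod_closed[OF X.a_subset Y.a_subset])
  have "\<ominus> s \<in> X \<cdot> Y" if "s \<in> X \<cdot> Y" for s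
    using that
  proof induct
    case (prod x y)
    then have "\<ominus> x \<otimes> y \<in> X \<cdot> Y" by (intro ideal_prod.prod) auto
    with prod show ?case by (simp add: l_minus)
  next
    case (sum s t)
    then have "s \<in> carrier R" "t \<in> carrier R" using closed by auto
    with sum show ?case by (simp add: minus_add ideal_prod.sum)
  qed
  moreover have "\<zero> \<in> X \<cdot> Y"
    using ideal_prod.prod[of \<zero> X \<zero> Y R] by simp
  ultimately show ?thesis
    using closed
    by (intro additive_subgroup.intro add.subgroupI) (auto intro: ideal_prod.sum)
qed

lemma carrier_additive_subgroup: "additive_subgroup (carrier R) R"
  by (rule additive_subgroup.intro) (rule add.subgroup_self)

lemma ideal_carrier_prod:
  assumes "right_ideal X R"
  shows "ideal (carrier R \<cdot> X) R"
proof -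
  interpret X: right_ideal X R by (rule assms)
  have sub: "additive_subgroup (carrier R \<cdot> X) R"
    by (rule additive_subgroup_ideal_prod[OF carrier_additive_subgroup X.is_additive_subgroup])
  have closed: "carrier R \<cdot> X \<subseteq> carrier R"
    by (rule ideal_prod_closed[OF subset_refl X.a_subset])
  show ?thesis
  proof (rule idealI[OF ring_axioms additive_subgroup.a_subgroup[OF sub]])
    fix s a assume s: "s \<in> carrier R \<cdot> X" and a: "a \<in> carrier R"
    show "a \<otimes> s \<in> carrier R \<cdot> X"
      using s
    proof induct
      case (prod r x)
      then have "(a \<otimes> r) \<otimes> x \<in> carrier R \<cdot> X" using a by (intro ideal_prod.prod) auto
      with prod a show ?case by (simp add: m_assoc)
    next
      case (sum s t)
      then have "s \<in> carrier R" "t \<in> carrier R" using closed by auto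
      with sum a show ?case by (simp add: r_distr ideal_prod.sum)
    qed
    show "s \<otimes> a \<in> carrier R \<cdot> X"
      using s
    proof induct
      case (prod r x)
      then have "r \<otimes> (x \<otimes> a) \<in> carrier R \<cdot> X"
        using a by (intro ideal_prod.prod X.right_closed) auto
      with prod a show ?case by (simp add: m_assoc)
    next
      case (sum s t)
      then have "s \<in> carrier R" "t \<in> carrier R" using closed by auto
      with sum a show ?case by (simp add: l_distr ideal_prod.sum)
    qed
  qed
qed

text \<open>This is where the unit of the ring enters: \<open>x = 1x\<close>.\<close>

lemma subset_carrier_prod:
  assumes "X \<subseteq> carrier R"
  shows "X \<subseteq> carrier R \<cdot> X"
proof
  fix x assume "x \<in> X"
  then show "x \<in> carrier R \<cdot> X"
    using ideal_prod.prod[of \<one> "carrier R" x X R] assms by auto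
qed

text \<open>
  On generators, \<open>(rx)(sy) = r((xs)y)\<close>: the right ideal \<open>X\<close> absorbs \<open>s\<close>, and \<open>P\<close> absorbs \<open>r\<close>.
\<close>

lemma carrier_prod_prod_subset:
  assumes "right_ideal X R" and Y: "Y \<subseteq> carrier R" and "ideal P R" and XY: "X \<cdot> Y \<subseteq> P"
  shows "(carrier R \<cdot> X) \<cdot> (carrier R \<cdot> Y) \<subseteq> P"
proof -
  interpret X: right_ideal X R by (rule assms)
  interpret P: ideal P R by (rule assms)
  have RY: "carrier R \<cdot> Y \<subseteq> carrier R"
    by (rule ideal_prod_closed[OF subset_refl Y])
  have RX: "carrier R \<cdot> X \<subseteq> carrier R"
    by (rule ideal_prod_closed[OF subset_refl X.a_subset])
  have X_RY: "x \<otimes> t \<in> P" if x: "x \<in> X" and t: "t \<in> carrier R \<cdot> Y" for x t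
    using t
  proof induct
    case (prod s y)
    have "(x \<otimes> s) \<otimes> y \<in> P"
      using XY prod x by (auto intro: ideal_prod.prod X.right_closed)
    with prod x Y show ?case by (simp add: m_assoc subset_eq)
  next
    case (sum t u)
    then have "t \<in> carrier R" "u \<in> carrier R" using RY by auto
    with sum x show ?case by (simp add: r_distr)
  qed
  have "s \<otimes> t \<in> P" if s: "s \<in> carrier R \<cdot> X" and t: "t \<in> carrier R \<cdot> Y" for s t
    using s
  proof induct
    case (prod r x)
    have "r \<otimes> (x \<otimes> t) \<in> P"
      using prod t by (intro P.I_l_closed X_RY)
    with prod t RY show ?case by (simp add: m_assoc subset_eq)
  next
    case (sum s u)
    then have "s \<in> carrier R" "u \<in> carrier R" "t \<in> carrier R" using RX RY t by auto
    with sum show ?case by (simp add: l_distr)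
  qed
  then show ?thesis
    by (rule ideal_prod_subset_additive_subgroup[OF P.is_additive_subgroup])
qed

end

section \<open>Homogeneous components\<close>

context graded_ring
begin

abbreviation component :: "'g \<Rightarrow> 'a \<Rightarrow> 'a"
  where "component \<equiv> homogeneous_component G R A"

lemma component_subset_carrier: "g \<in> carrier G \<Longrightarrow> A g \<subseteq> carrier R"
  by (rule additive_subgroup.a_subset[OF component_subgroup])

lemma decomposition_component:
  assumes "x \<in> carrier R"
  shows "homogeneous_decomposition G R A x (\<lambda>g. component g x)"
  using theI'[OF direct_sum[OF assms]] by (simp add: homogeneous_component_def)

lemma component_in:
  assumes "x \<in> carrier R" and "g \<in> carrier G"
  shows "component g x \<in> A g"
  using decomposition_component[OF assms(1)] assms(2)
  by (auto simp: homogeneous_decomposition_def)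

text \<open>
  By uniqueness of decompositions, components can be read off from any finite sum of homogeneous
  elements of distinct degrees. The index set \<open>F\<close> may be larger than the support, so that two
  decompositions can be compared over a common index set.
\<close>

lemma component_eqI:
  assumes F: "finite F" "F \<subseteq> carrier G"
    and f: "\<And>g. g \<in> carrier G \<Longrightarrow> f g \<in> A g"
    and zero: "\<And>g. g \<in> carrier G \<Longrightarrow> g \<notin> F \<Longrightarrow> f g = \<zero>\<^bsub>R\<^esub>"
    and k: "k \<in> carrier G"
  shows "component k (finsum R f F) = f k"
proof -
  let ?f = "restrict f (carrier G)"
  let ?S = "{g \<in> carrier G. ?f g \<noteq> \<zero>\<^bsub>R\<^esub>}"
  have fR: "f g \<in> carrier R" if "g \<in> carrier G" for g
    using f component_subset_carrier that by blast
  have S: "?S \<subseteq> F" using zero by (auto split: if_splits)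
  have eq: "finsum R f F = finsum R ?f ?S"
    by (rule add.finprod_mono_neutral_cong_right) (use F S fR in \<open>auto split: if_splits\<close>)
  have "homogeneous_decomposition G R A (finsum R f F) ?f"
    unfolding homogeneous_decomposition_def using f eq finite_subset[OF S] F by auto
  moreover have "finsum R f F \<in> carrier R"
    using F fR by (intro finsum_closed) auto
  ultimately have "(THE f'. homogeneous_decomposition G R A (finsum R f F) f') = ?f"
    using direct_sum by (intro the1_equality) auto
  with k show ?thesis by (simp add: homogeneous_component_def)
qed

lemma sum_components:
  assumes "x \<in> carrier R"
  obtains F where "finite F" and "F \<subseteq> carrier G"
    and "\<And>g. g \<in> carrier G \<Longrightarrow> g \<notin> F \<Longrightarrow> component g x = \<zero>\<^bsub>R\<^esub>"
    and "\<And>F'. finite F' \<Longrightarrow> F \<subseteq> F' \<Longrightarrow> F' \<subseteq> carrier G \<Longrightarrow> x = finsum R (\<lambda>g. component g x) F'"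
proof
  let ?F = "{g \<in> carrier G. component g x \<noteq> \<zero>\<^bsub>R\<^esub>}"
  have dec: "finite ?F" "x = finsum R (\<lambda>g. component g x) ?F"
    using decomposition_component[OF assms] by (auto simp: homogeneous_decomposition_def)
  show "finite ?F" by (rule dec)
  show "?F \<subseteq> carrier G" by auto
  show "component g x = \<zero>\<^bsub>R\<^esub>" if "g \<in> carrier G" "g \<notin> ?F" for g
    using that by auto
  show "x = finsum R (\<lambda>g. component g x) F'"
    if F': "finite F'" "?F \<subseteq> F'" "F' \<subseteq> carrier G" for F'
  proof -
    have "component g x \<in> carrier R" if "g \<in> F'" for g
      using component_in[OF assms] component_subset_carrier F' that by blast
    then have "finsum R (\<lambda>g. component g x) ?F = finsum R (\<lambda>g. component g x) F'"
      by (intro add.finprod_mono_neutral_cong_left) (use F' in auto)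
    with dec show ?thesis by simp
  qed
qed

lemma component_homogeneous:
  assumes g: "g \<in> carrier G" and x: "x \<in> A g" and k: "k \<in> carrier G"
  shows "component k x = (if k = g then x else \<zero>\<^bsub>R\<^esub>)"
proof -
  let ?f = "\<lambda>h. if h = g then x else \<zero>\<^bsub>R\<^esub>"
  have "component k (finsum R ?f {g}) = ?f k"
    using x g k component_subgroup
    by (intro component_eqI) (auto intro: additive_subgroup.zero_closed)
  moreover have "x \<in> carrier R" using component_subset_carrier g x by blast
  ultimately show ?thesis by simp
qed

lemma component_add:
  assumes x: "x \<in> carrier R" and y: "y \<in> carrier R" and k: "k \<in> carrier G"
  shows "component k (x \<oplus>\<^bsub>R\<^esub> y) = component k x \<oplus>\<^bsub>R\<^esub> component k y"
proof -
  obtain F where F: "finite F" "F \<subseteq> carrier G"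
    "\<And>g. g \<in> carrier G \<Longrightarrow> g \<notin> F \<Longrightarrow> component g x = \<zero>\<^bsub>R\<^esub>"
    "\<And>F'. finite F' \<Longrightarrow> F \<subseteq> F' \<Longrightarrow> F' \<subseteq> carrier G \<Longrightarrow> x = finsum R (\<lambda>g. component g x) F'"
    using sum_components[OF x] by blast
  obtain F' where F': "finite F'" "F' \<subseteq> carrier G"
    "\<And>g. g \<in> carrier G \<Longrightarrow> g \<notin> F' \<Longrightarrow> component g y = \<zero>\<^bsub>R\<^esub>"
    "\<And>E. finite E \<Longrightarrow> F' \<subseteq> E \<Longrightarrow> E \<subseteq> carrier G \<Longrightarrow> y = finsum R (\<lambda>g. component g y) E"
    using sum_components[OF y] by blast
  let ?f = "\<lambda>g. component g x \<oplus>\<^bsub>R\<^esub> component g y"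
  have carr: "component g x \<in> carrier R" "component g y \<in> carrier R" if "g \<in> F \<union> F'" for g
    using component_in x y component_subset_carrier F(2) F'(2) that by blast+
  have "finsum R ?f (F \<union> F') =
      finsum R (\<lambda>g. component g x) (F \<union> F') \<oplus>\<^bsub>R\<^esub> finsum R (\<lambda>g. component g y) (F \<union> F')"
    using carr by (intro finsum_addf) auto
  also have "\<dots> = x \<oplus>\<^bsub>R\<^esub> y"
    using F(4)[of "F \<union> F'"] F'(4)[of "F \<union> F'"] F(1,2) F'(1,2) by simp
  finally have sum: "x \<oplus>\<^bsub>R\<^esub> y = finsum R ?f (F \<union> F')" by simp
  show ?thesis
    unfolding sum
  proof (rule component_eqI[OF _ _ _ _ k])
    show "?f g \<in> A g" if "g \<in> carrier G" for g
      using that x y by (intro additive_subgroup.a_closed[OF component_subgroup] component_in)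
    show "?f g = \<zero>\<^bsub>R\<^esub>" if "g \<in> carrier G" "g \<notin> F \<union> F'" for g
      using that F(3) F'(3) by simp
  qed (use F F' in auto)
qed

text \<open>
  Additive statements about an element reduce to its components. Membership in \<open>carrier R\<close> comes
  with the sums so that distributivity applies.
\<close>

lemma component_induct:
  assumes x: "x \<in> carrier R"
    and zero: "Q \<zero>\<^bsub>R\<^esub>"
    and add: "\<And>y z. \<lbrakk>y \<in> carrier R; z \<in> carrier R; Q y; Q z\<rbrakk> \<Longrightarrow> Q (y \<oplus>\<^bsub>R\<^esub> z)"
    and comp: "\<And>g. g \<in> carrier G \<Longrightarrow> Q (component g x)"
  shows "Q x"
proof -
  obtain F where F: "finite F" "F \<subseteq> carrier G" "x = finsum R (\<lambda>g. component g x) F"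
    using sum_components[OF x] by (metis subset_refl)
  have "Q (finsum R (\<lambda>g. component g x) F)"
    using F(1,2)
  proof induct
    case empty
    then show ?case using zero by simp
  next
    case (insert g E)
    have carr: "component h x \<in> carrier R" if "h \<in> insert g E" for h
      using component_in[OF x] component_subset_carrier insert.prems that by blast
    then have "finsum R (\<lambda>g. component g x) (insert g E) =
        component g x \<oplus>\<^bsub>R\<^esub> finsum R (\<lambda>g. component g x) E"
      using insert.hyps by (intro finsum_insert) auto
    moreover have "finsum R (\<lambda>g. component g x) E \<in> carrier R"
      using carr by (intro finsum_closed) auto
    ultimately show ?case
      using insert carr by (auto intro: add comp)
  qed
  with F(3) show ?thesis by simp
qed

section \<open>Products of graded subgroups are graded\<close>

lemma graded_subset_carrier: "graded_subset G R A (carrier R)"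
  unfolding graded_subset_def using component_in component_subset_carrier by blast

lemma graded_subset_ideal_prod:
  assumes X: "additive_subgroup X R" "graded_subset G R A X"
    and Y: "additive_subgroup Y R" "graded_subset G R A Y"
  shows "graded_subset G R A (X \<cdot>\<^bsub>R\<^esub> Y)"
proof -
  interpret X: additive_subgroup X R by (rule X)
  interpret Y: additive_subgroup Y R by (rule Y)
  interpret XY: additive_subgroup "X \<cdot>\<^bsub>R\<^esub> Y" R
    by (rule additive_subgroup_ideal_prod[OF X(1) Y(1)])
  define Q where "Q z \<longleftrightarrow> (\<forall>k\<in>carrier G. component k z \<in> X \<cdot>\<^bsub>R\<^esub> Y)" for z
  have Q_zero: "Q \<zero>\<^bsub>R\<^esub>"
  proof -
    have "component k \<zero>\<^bsub>R\<^esub> = \<zero>\<^bsub>R\<^esub>" if "k \<in> carrier G" for k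
      using component_homogeneous[OF that _ that] component_subgroup[OF that]
      by (simp add: additive_subgroup.zero_closed)
    then show ?thesis by (simp add: Q_def)
  qed
  have Q_add: "Q (y \<oplus>\<^bsub>R\<^esub> z)" if "y \<in> carrier R" "z \<in> carrier R" "Q y" "Q z" for y z
    using that by (simp add: Q_def component_add)
  have Q_homogeneous: "Q (x \<otimes>\<^bsub>R\<^esub> y)"
    if gh: "g \<in> carrier G" "h \<in> carrier G" and x: "x \<in> X" "x \<in> A g" and y: "y \<in> Y" "y \<in> A h"
    for g h x y
  proof -
    have "x \<otimes>\<^bsub>R\<^esub> y \<in> A (g \<otimes>\<^bsub>G\<^esub> h)" "g \<otimes>\<^bsub>G\<^esub> h \<in> carrier G"
      using mult_graded gh x y by auto
    moreover have "x \<otimes>\<^bsub>R\<^esub> y \<in> X \<cdot>\<^bsub>R\<^esub> Y" using x y by (intro ideal_prod.prod)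
    ultimately show ?thesis by (simp add: Q_def component_homogeneous)
  qed
  have comp_X: "component g x \<in> X" if "x \<in> X" "g \<in> carrier G" for x g
    using X(2) that by (simp add: graded_subset_def)
  have comp_Y: "component g y \<in> Y" if "y \<in> Y" "g \<in> carrier G" for y g
    using Y(2) that by (simp add: graded_subset_def)
  have Q_prod: "Q (x \<otimes>\<^bsub>R\<^esub> y)" if x: "x \<in> X" and y: "y \<in> Y" for x y
  proof (rule component_induct[where Q = "\<lambda>u. Q (u \<otimes>\<^bsub>R\<^esub> y)"])
    fix g assume g: "g \<in> carrier G"
    have xg: "component g x \<in> X" "component g x \<in> A g"
      using comp_X component_in x g by auto
    show "Q (component g x \<otimes>\<^bsub>R\<^esub> y)"
    proof (rule component_induct[where Q = "\<lambda>v. Q (component g x \<otimes>\<^bsub>R\<^esub> v)"])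
      fix h assume h: "h \<in> carrier G"
      then show "Q (component g x \<otimes>\<^bsub>R\<^esub> component h y)"
        using xg comp_Y component_in y by (intro Q_homogeneous[OF g h]) auto
    qed (use xg y in \<open>auto simp: r_distr Q_zero intro: Q_add\<close>)
  qed (use x y in \<open>auto simp: l_distr Q_zero intro: Q_add\<close>)
  have "Q s" if "s \<in> X \<cdot>\<^bsub>R\<^esub> Y" for s
    using that
    by induct (use XY.a_subset in \<open>auto intro: Q_prod Q_add\<close>)
  then show ?thesis by (simp add: graded_subset_def Q_def)
qed

lemma graded_two_sided_ideal_carrier_prod:
  assumes "graded_right_ideal G R A X"
  shows "graded_two_sided_ideal G R A (carrier R \<cdot>\<^bsub>R\<^esub> X)"
  using assms carrier_additive_subgroup graded_subset_carrier
  by (auto simp: graded_two_sided_ideal_def graded_right_ideal_def right_ideal_def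
      intro: ideal_carrier_prod graded_subset_ideal_prod)

lemma graded_two_sided_ideal_imp_right:
  "graded_two_sided_ideal G R A X \<Longrightarrow> graded_right_ideal G R A X"
  by (simp add: graded_two_sided_ideal_def graded_right_ideal_def ideal_imp_right_ideal)

end

section \<open>Almost prime ideals\<close>

theorem proposition2p5:
  fixes G :: "('g, 'h) monoid_scheme"
    and R :: "('a, 'r) ring_scheme"
    and A :: "'g \<Rightarrow> 'a set"
    and P :: "'a set"
  assumes "graded_ring G R A"
    and "graded_two_sided_ideal G R A P"
    and "P \<noteq> carrier R"
  shows "graded_almost_prime_right_ideal G R A P \<longleftrightarrow> graded_almost_prime_ideal G R A P"
proof
  interpret graded_ring G R A by (rule assms(1))
  show "graded_almost_prime_ideal G R A P" if "graded_almost_prime_right_ideal G R A P"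
    using that assms(2) graded_two_sided_ideal_imp_right
    by (simp add: graded_almost_prime_right_ideal_def graded_almost_prime_ideal_def)
  show "graded_almost_prime_right_ideal G R A P" if prime: "graded_almost_prime_ideal G R A P"
    unfolding graded_almost_prime_right_ideal_def
  proof (intro conjI allI impI)
    show "graded_right_ideal G R A P"
      by (rule graded_two_sided_ideal_imp_right[OF assms(2)])
    show "P \<noteq> carrier R" by (rule assms(3))
    fix X Y
    assume *: "graded_right_ideal G R A X \<and> graded_right_ideal G R A Y \<and>
      X \<cdot>\<^bsub>R\<^esub> Y \<subseteq> P \<and> \<not> X \<cdot>\<^bsub>R\<^esub> Y \<subseteq> P \<cdot>\<^bsub>R\<^esub> P"
    let ?RX = "carrier R \<cdot>\<^bsub>R\<^esub> X" and ?RY = "carrier R \<cdot>\<^bsub>R\<^esub> Y"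
    have right: "right_ideal X R" "right_ideal Y R"
      using * by (auto simp: graded_right_ideal_def)
    then have carr: "X \<subseteq> carrier R" "Y \<subseteq> carrier R"
      by (auto simp: right_ideal_def dest: additive_subgroup.a_subset)
    have sub: "X \<subseteq> ?RX" "Y \<subseteq> ?RY"
      using carr by (simp_all add: subset_carrier_prod)
    have "?RX \<cdot>\<^bsub>R\<^esub> ?RY \<subseteq> P"
      using carrier_prod_prod_subset[OF right(1) carr(2)] assms(2) *
      by (simp add: graded_two_sided_ideal_def)
    moreover have "\<not> ?RX \<cdot>\<^bsub>R\<^esub> ?RY \<subseteq> P \<cdot>\<^bsub>R\<^esub> P"
      using * ideal_prod_mono[OF sub, of R] by blast
    moreover have "graded_two_sided_ideal G R A ?RX" "graded_two_sided_ideal G R A ?RY"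
      using * by (simp_all add: graded_two_sided_ideal_carrier_prod)
    ultimately have "?RX \<subseteq> P \<or> ?RY \<subseteq> P"
      using prime unfolding graded_almost_prime_ideal_def by blast
    with sub show "X \<subseteq> P \<or> Y \<subseteq> P" by blast
  qed
qed

end
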